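(* Let $\alpha=\frac{1+\sqrt5}{2}$ and $\beta=\frac{1-\sqrt5}{2}$. Then for every integer $n\ge 0$ the hybrid Fibonacci spinor $FSH_n$ satisfies $$FSH_n=\begin{bmatrix}\frac{1}{\sqrt5}+h\left(\frac{3+\sqrt5}{2\sqrt5}\right)\\[2pt] \frac{1}{\sqrt5}+h\left(\frac{2+\sqrt5}{\sqrt5}\right)\end{bmatrix}\alpha^n+\begin{bmatrix}-\frac{1}{\sqrt5}-h\left(\frac{3-\sqrt5}{2\sqrt5}\right)\\[2pt] -\frac{1}{\sqrt5}-h\left(\frac{2-\sqrt5}{\sqrt5}\right)\end{bmatrix}\beta^n .$$
   Context: $h$ is the hyperbolic unit: $h^2=1$, $h\notin\mathbb{R}$, so entries lie in the commutative ring of hyperbolic (split-complex) numbers $\{a+hb: a,b\in\mathbb{R}\}\cong\mathbb{R}[h]/(h^2-1)$. $F_n$ is the Fibonacci sequence: $F_0=0$, $F_1=1$, $F_{n+1}=F_n+F_{n-1}$. The $n$th hybrid Fibonacci spinor ($n\ge0$) is the column vector $$FSH_n=\begin{bmatrix}F_n+hF_{n+2}\\ (F_{n+2}-F_{n+1})+hF_{n+3}\end{bmatrix}.$$ *)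

theory Defs
  imports "HOL-Analysis.Finite_Cartesian_Product" "HOL-Analysis.Cartesian_Space" "HOL-Number_Theory.Fib"
begin

text \<open>
  Hyperbolic (split-complex) numbers \<open>a + h b\<close> with real \<open>a\<close>, \<open>b\<close> and \<open>h\<^sup>2 = 1\<close>.
  The pair representation uses the basis \<open>1, h\<close>, so the product is that of
  the quotient of the real polynomial ring in \<open>h\<close> by \<open>h\<^sup>2 - 1\<close>.
\<close>

datatype hyperbolic = Hyperbolic (hRe: real) (hIm: real)

lemma hyperbolic_eq_iff: "x = y \<longleftrightarrow> hRe x = hRe y \<and> hIm x = hIm y"
  by (cases x; cases y) simp

instantiation hyperbolic :: "{comm_ring_1, real_algebra_1}"
begin

definition "0 = Hyperbolic 0 0"
definition "1 = Hyperbolic 1 0"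
definition "x + y = Hyperbolic (hRe x + hRe y) (hIm x + hIm y)"
definition "x - y = Hyperbolic (hRe x - hRe y) (hIm x - hIm y)"
definition "- x = Hyperbolic (- hRe x) (- hIm x)"
definition "x * y = Hyperbolic (hRe x * hRe y + hIm x * hIm y) (hRe x * hIm y + hIm x * hRe y)"
definition "r *\<^sub>R x = Hyperbolic (r * hRe x) (r * hIm x)"

instance
  by standard
    (simp_all add: hyperbolic_eq_iff zero_hyperbolic_def one_hyperbolic_def plus_hyperbolic_def
      minus_hyperbolic_def uminus_hyperbolic_def times_hyperbolic_def scaleR_hyperbolic_def
      algebra_simps)

end

definition hyp_unit :: hyperbolic  (\<open>\<h>\<close>)
  where "\<h> = Hyperbolic 0 1"

lemma hyp_unit_square: "\<h>\<^sup>2 = 1"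
  by (simp add: hyp_unit_def power2_eq_square times_hyperbolic_def one_hyperbolic_def)

lemma hyp_unit_not_real: "\<h> \<notin> \<real>"
  by (auto simp: Reals_def of_real_def hyp_unit_def scaleR_hyperbolic_def one_hyperbolic_def)

lemma hyperbolic_expansion: "Hyperbolic a b = of_real a + \<h> * of_real b"
  by (simp add: of_real_def hyp_unit_def scaleR_hyperbolic_def one_hyperbolic_def
      plus_hyperbolic_def times_hyperbolic_def)

definition FSH :: "nat \<Rightarrow> hyperbolic ^ 2"
  where "FSH n = vector
    [of_nat (fib n) + \<h> * of_nat (fib (n + 2)),
     (of_nat (fib (n + 2)) - of_nat (fib (n + 1))) + \<h> * of_nat (fib (n + 3))]"

end

theory Submission imports Defs begin

text \<open>In the basis 1, h the entries of \<open>FSH n\<close> have real parts F_n and F_(n+2) -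
  F_(n+1) = F_n, and h-parts F_(n+2) and F_(n+3). Binet's formula, with \<alpha>^(n+k) split as
  \<alpha>^k \<alpha>^n and likewise for \<beta> (\<open>fib_Binet_shift\<close>), makes each of
  them a fixed combination of \<alpha>^n and \<beta>^n. The coefficients \<alpha>^k / sqrt 5 and
  -\<beta>^k / sqrt 5 for k = 0, 2, 3 are the entries of the two constant vectors.\<close>

lemma fib_Binet_shift:
  fixes \<alpha> \<beta> :: real
  defines "\<alpha> \<equiv> (1 + sqrt 5) / 2" and "\<beta> \<equiv> (1 - sqrt 5) / 2"
  shows "of_nat (fib (n + k)) = (\<alpha> ^ k / sqrt 5) * \<alpha> ^ n - (\<beta> ^ k / sqrt 5) * \<beta> ^ n"
  using fib_closed_form[of "n + k"]
  by (simp add: \<alpha>_def \<beta>_def power_add diff_divide_distrib mult.commute)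

text \<open>Coordinate rules that reduce an equation between hyperbolic numbers to two real
  equations, to which Binet's formula applies.\<close>

lemma hRe_simps [simp]:
  "hRe \<h> = 0" "hRe (x + y) = hRe x + hRe y" "hRe (x - y) = hRe x - hRe y"
  "hRe (- x) = - hRe x" "hRe (x * y) = hRe x * hRe y + hIm x * hIm y" "hRe (r *\<^sub>R x) = r * hRe x"
  "hRe (of_real r) = r" "hRe (of_nat m) = of_nat m"
  and hIm_simps [simp]:
  "hIm \<h> = 1" "hIm (x + y) = hIm x + hIm y" "hIm (x - y) = hIm x - hIm y"
  "hIm (- x) = - hIm x" "hIm (x * y) = hRe x * hIm y + hIm x * hRe y" "hIm (r *\<^sub>R x) = r * hIm x"
  "hIm (of_real r) = 0" "hIm (of_nat m) = 0"
proof -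
  note defs = one_hyperbolic_def hyp_unit_def plus_hyperbolic_def
    minus_hyperbolic_def uminus_hyperbolic_def times_hyperbolic_def scaleR_hyperbolic_def
  show
    "hRe \<h> = 0" "hRe (x + y) = hRe x + hRe y" "hRe (x - y) = hRe x - hRe y"
    "hRe (- x) = - hRe x" "hRe (x * y) = hRe x * hRe y + hIm x * hIm y" "hRe (r *\<^sub>R x) = r * hRe x"
    "hIm \<h> = 1" "hIm (x + y) = hIm x + hIm y" "hIm (x - y) = hIm x - hIm y"
    "hIm (- x) = - hIm x" "hIm (x * y) = hRe x * hIm y + hIm x * hRe y" "hIm (r *\<^sub>R x) = r * hIm x"
    by (simp_all add: defs)
  show re: "hRe (of_real r) = r" and im: "hIm (of_real r) = 0" for r
    by (simp_all add: of_real_def defs)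
  \<comment> \<open>A natural number enters the hyperbolic numbers through the reals, so this is the
    previous case at r = m.\<close>
  show "hRe (of_nat m) = of_nat m" "hIm (of_nat m) = 0"
    using re[of "of_nat m"] im[of "of_nat m"] by simp_all
qed

theorem theorem4p3:
  fixes \<alpha> \<beta> :: real and n :: nat
  assumes "\<alpha> = (1 + sqrt 5) / 2"
    and "\<beta> = (1 - sqrt 5) / 2"
  shows "FSH n =
      \<alpha> ^ n *\<^sub>R vector
        [of_real (1 / sqrt 5) + \<h> * of_real ((3 + sqrt 5) / (2 * sqrt 5)),
         of_real (1 / sqrt 5) + \<h> * of_real ((2 + sqrt 5) / sqrt 5)]
    + \<beta> ^ n *\<^sub>R vector
        [- of_real (1 / sqrt 5) - \<h> * of_real ((3 - sqrt 5) / (2 * sqrt 5)),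
         - of_real (1 / sqrt 5) - \<h> * of_real ((2 - sqrt 5) / sqrt 5)]"
proof -
  have shift: "of_nat (fib (n + k)) = (\<alpha> ^ k / sqrt 5) * \<alpha> ^ n - (\<beta> ^ k / sqrt 5) * \<beta> ^ n" for k
    unfolding assms by (rule fib_Binet_shift)
  \<comment> \<open>These powers are the numerators of the h-parts: shift 2 for the first entry,
    shift 3 for the second.\<close>
  have squares: "\<alpha> ^ 2 = (3 + sqrt 5) / 2" "\<beta> ^ 2 = (3 - sqrt 5) / 2"
    by (simp_all add: assms power2_eq_square field_simps)
  have cubes: "\<alpha> ^ 3 = 2 + sqrt 5" "\<beta> ^ 3 = 2 - sqrt 5"
    by (simp_all add: assms power3_eq_cube field_simps)
  have F0: "of_nat (fib n) = 1 / sqrt 5 * \<alpha> ^ n - 1 / sqrt 5 * \<beta> ^ n"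
    using shift[of 0] by simp
  have F2: "of_nat (fib (n + 2)) =
      (3 + sqrt 5) / (2 * sqrt 5) * \<alpha> ^ n - (3 - sqrt 5) / (2 * sqrt 5) * \<beta> ^ n"
    using shift[of 2] by (simp add: squares)
  have F3: "of_nat (fib (n + 3)) = (2 + sqrt 5) / sqrt 5 * \<alpha> ^ n - (2 - sqrt 5) / sqrt 5 * \<beta> ^ n"
    using shift[of 3] by (simp only: cubes)
  \<comment> \<open>The recurrence explains why both entries share the real coefficients 1 / sqrt 5
    and -1 / sqrt 5.\<close>
  have F21: "of_nat (fib (n + 2)) - of_nat (fib (n + 1)) = (of_nat (fib n) :: real)"
    by simp
  show ?thesis
    unfolding FSH_def vec_eq_iff forall_2 hyperbolic_eq_iff vector_add_component
      vector_scaleR_component vector_2 hRe_simps hIm_simps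
    \<comment> \<open>\<open>F21\<close> goes first: rewriting with \<open>F2\<close> would break up
      the difference that it matches.\<close>
    unfolding F21 unfolding F0 F2 F3
    by (simp add: mult.commute)
qed

end
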